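(* Let $\mathbb{K}$ be a field of characteristic $0$ and let $(A,\mu)$ be an associative commutative $\mathbb{K}$-algebra. Let $\mu_t=\mu+t\varphi_1+t^2\varphi_2+\cdots$ be any weakly associative formal deformation of $\mu$, and put $\psi_{\varphi_1}(X,Y)=\varphi_1(X,Y)-\varphi_1(Y,X)$. Then $(A,\mu,\psi_{\varphi_1})$ is a (classical) Poisson algebra, and $(A[[t]],\mu_t)$ is a quantization of this Poisson algebra. Moreover, the Poisson structure so constructed on $A$ depends only on the equivalence class of the formal deformation $\mu_t$ of $\mu$.
   Context: The associator of a bilinear multiplication $\ast$ is $\mathcal{A}_\ast(X,Y,Z)=X\ast(Y\ast Z)-(X\ast Y)\ast Z$. An algebra is weakly associative if $\mathcal{A}_\ast(X,Y,Z)+\mathcal{A}_\ast(Y,Z,X)-\mathcal{A}_\ast(Y,X,Z)=0$ for all $X,Y,Z$ (every associative algebra is weakly associative). A weakly associative formal deformation of $(A,\mu)$ is a bilinear map $\mu_t:A\otimes A\to A[[t]]$ of the form $\mu_t=\mu+t\varphi_1+t^2\varphi_2+\cdots$, with each $\varphi_i:A\otimes A\to A$ bilinear, whose $\mathbb{K}[[t]]$-bilinear extension to $A[[t]]$ makes $A[[t]]$ a weakly associative $\mathbb{K}[[t]]$-algebra. Two such deformations $\mu_t,\mu'_t$ of $\mu$ are equivalent if there is an isomorphism of $\mathbb{K}[[t]]$-algebras $f_t:(A[[t]],\mu_t)\to(A[[t]],\mu'_t)$ with $f_t=\mathrm{Id}+\sum_{n\ge1}t^n h_n$, the $h_n$ being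 linear endomorphisms of $A$. A Poisson algebra is a triple $(A,\mu,\psi)$ where $\mu$ (written $XY$) is a commutative associative multiplication, $\psi$ is a Lie bracket, and $\psi(XY,Z)=X\psi(Y,Z)+\psi(X,Z)Y$ for all $X,Y,Z\in A$. By definition, $(A[[t]],\mu_t)$ is a quantization of the Poisson algebra $(A,\mu,\psi)$ when $\mu_t$ is a (weakly associative) formal deformation of $\mu$ and $\psi=\psi_{\varphi_1}$ is the Poisson bracket obtained from its first-order term. *)

theory Defs
  imports "HOL-Computational_Algebra.Formal_Power_Series"
begin

definition bilinear_mult ::
  "('r::comm_ring_1 \<Rightarrow> 'a::ab_group_add \<Rightarrow> 'a) \<Rightarrow> ('a \<Rightarrow> 'a \<Rightarrow> 'a) \<Rightarrow> bool" where
  "bilinear_mult s m \<longleftrightarrow>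
     (\<forall>x. module_hom s s (\<lambda>y. m x y)) \<and> (\<forall>y. module_hom s s (\<lambda>x. m x y))"

definition associator :: "('a::ab_group_add \<Rightarrow> 'a \<Rightarrow> 'a) \<Rightarrow> 'a \<Rightarrow> 'a \<Rightarrow> 'a \<Rightarrow> 'a" where
  "associator m x y z = m x (m y z) - m (m x y) z"

definition weakly_associative_algebra ::
  "('r::comm_ring_1 \<Rightarrow> 'a::ab_group_add \<Rightarrow> 'a) \<Rightarrow> ('a \<Rightarrow> 'a \<Rightarrow> 'a) \<Rightarrow> bool" where
  "weakly_associative_algebra s m \<longleftrightarrow> bilinear_mult s m \<and>
     (\<forall>x y z. associator m x y z + associator m y z x - associator m y x z = 0)"

definition comm_assoc_algebra ::
  "('r::comm_ring_1 \<Rightarrow> 'a::ab_group_add \<Rightarrow> 'a) \<Rightarrow> ('a \<Rightarrow> 'a \<Rightarrow> 'a) \<Rightarrow> bool" where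
  "comm_assoc_algebra s m \<longleftrightarrow> bilinear_mult s m \<and>
     (\<forall>x y z. m (m x y) z = m x (m y z)) \<and> (\<forall>x y. m x y = m y x)"

definition lie_bracket ::
  "('r::comm_ring_1 \<Rightarrow> 'a::ab_group_add \<Rightarrow> 'a) \<Rightarrow> ('a \<Rightarrow> 'a \<Rightarrow> 'a) \<Rightarrow> bool" where
  "lie_bracket s \<psi> \<longleftrightarrow> bilinear_mult s \<psi> \<and> (\<forall>x. \<psi> x x = 0) \<and>
     (\<forall>x y z. \<psi> x (\<psi> y z) + \<psi> y (\<psi> z x) + \<psi> z (\<psi> x y) = 0)"

definition poisson_algebra ::
  "('r::comm_ring_1 \<Rightarrow> 'a::ab_group_add \<Rightarrow> 'a) \<Rightarrow> ('a \<Rightarrow> 'a \<Rightarrow> 'a) \<Rightarrow> ('a \<Rightarrow> 'a \<Rightarrow> 'a) \<Rightarrow> bool" where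
  "poisson_algebra s \<mu> \<psi> \<longleftrightarrow> comm_assoc_algebra s \<mu> \<and> lie_bracket s \<psi> \<and>
     (\<forall>x y z. \<psi> (\<mu> x y) z = \<mu> x (\<psi> y z) + \<mu> (\<psi> x z) y)"

text \<open>The type \<^typ>\<open>'a fps\<close> serves as \<open>A[[t]]\<close>, with the additive structure of the library
  and the following action of \<open>K[[t]]\<close>.\<close>

definition fps_scale ::
  "('k::comm_ring_1 \<Rightarrow> 'a::ab_group_add \<Rightarrow> 'a) \<Rightarrow> 'k fps \<Rightarrow> 'a fps \<Rightarrow> 'a fps" where
  "fps_scale s c x = Abs_fps (\<lambda>n. \<Sum>i\<le>n. s (fps_nth c i) (fps_nth x (n - i)))"

text \<open>For \<open>\<mu>t = \<Sum>i. t^i \<phi>\<^sub>i\<close>, the product of \<open>x\<close> and \<open>y\<close> has \<open>n\<close>-th coefficient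
  \<open>\<Sum> \<phi>\<^sub>i(x\<^sub>j, y\<^sub>k)\<close> over \<open>i + j + k = n\<close>. Lemmas \<open>bilinear_ext_bilinear\<close>,
  \<open>bilinear_ext_const\<close> and \<open>bilinear_ext_unique\<close> below show that this is the only
  \<open>K[[t]]\<close>-bilinear extension of \<open>\<mu>t\<close>.\<close>

definition bilinear_ext ::
  "('a::ab_group_add \<Rightarrow> 'a \<Rightarrow> 'a fps) \<Rightarrow> 'a fps \<Rightarrow> 'a fps \<Rightarrow> 'a fps" where
  "bilinear_ext \<mu>t x y = Abs_fps (\<lambda>n. \<Sum>i\<le>n. \<Sum>j\<le>n - i.
     fps_nth (\<mu>t (fps_nth x j) (fps_nth y (n - i - j))) i)"

definition deformation_term :: "('a \<Rightarrow> 'a \<Rightarrow> 'a fps) \<Rightarrow> nat \<Rightarrow> 'a \<Rightarrow> 'a \<Rightarrow> 'a" where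
  "deformation_term \<mu>t i x y = fps_nth (\<mu>t x y) i"

definition weakly_associative_deformation ::
  "('k::field \<Rightarrow> 'a::ab_group_add \<Rightarrow> 'a) \<Rightarrow> ('a \<Rightarrow> 'a \<Rightarrow> 'a) \<Rightarrow> ('a \<Rightarrow> 'a \<Rightarrow> 'a fps) \<Rightarrow> bool" where
  "weakly_associative_deformation s \<mu> \<mu>t \<longleftrightarrow>
     (\<forall>i. bilinear_mult s (deformation_term \<mu>t i)) \<and>
     deformation_term \<mu>t 0 = \<mu> \<and>
     weakly_associative_algebra (fps_scale s) (bilinear_ext \<mu>t)"

text \<open>The map \<open>\<Sum>n. t^n h\<^sub>n\<close> on \<open>A[[t]]\<close>, extended \<open>K[[t]]\<close>-linearly.\<close>

definition linear_ext :: "(nat \<Rightarrow> 'a::ab_group_add \<Rightarrow> 'a) \<Rightarrow> 'a fps \<Rightarrow> 'a fps" where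
  "linear_ext h x = Abs_fps (\<lambda>n. \<Sum>i\<le>n. h i (fps_nth x (n - i)))"

definition algebra_iso ::
  "('r::comm_ring_1 \<Rightarrow> 'a::ab_group_add \<Rightarrow> 'a) \<Rightarrow> ('a \<Rightarrow> 'a \<Rightarrow> 'a) \<Rightarrow> ('a \<Rightarrow> 'a \<Rightarrow> 'a) \<Rightarrow>
     ('a \<Rightarrow> 'a) \<Rightarrow> bool" where
  "algebra_iso s m m' f \<longleftrightarrow>
     module_hom s s f \<and> bij f \<and> (\<forall>x y. f (m x y) = m' (f x) (f y))"

definition equivalent_deformations ::
  "('k::field \<Rightarrow> 'a::ab_group_add \<Rightarrow> 'a) \<Rightarrow> ('a \<Rightarrow> 'a \<Rightarrow> 'a fps) \<Rightarrow> ('a \<Rightarrow> 'a \<Rightarrow> 'a fps) \<Rightarrow> bool" where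
  "equivalent_deformations s \<mu>t \<mu>t' \<longleftrightarrow>
     (\<exists>h. h 0 = id \<and> (\<forall>n. module_hom s s (h n)) \<and>
        algebra_iso (fps_scale s) (bilinear_ext \<mu>t) (bilinear_ext \<mu>t') (linear_ext h))"

definition skew_bracket :: "('a::ab_group_add \<Rightarrow> 'a \<Rightarrow> 'a) \<Rightarrow> 'a \<Rightarrow> 'a \<Rightarrow> 'a" where
  "skew_bracket \<phi> x y = \<phi> x y - \<phi> y x"

definition quantization ::
  "('k::field \<Rightarrow> 'a::ab_group_add \<Rightarrow> 'a) \<Rightarrow> ('a \<Rightarrow> 'a \<Rightarrow> 'a) \<Rightarrow> ('a \<Rightarrow> 'a \<Rightarrow> 'a) \<Rightarrow>
     ('a \<Rightarrow> 'a \<Rightarrow> 'a fps) \<Rightarrow> bool" where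
  "quantization s \<mu> \<psi> \<mu>t \<longleftrightarrow> poisson_algebra s \<mu> \<psi> \<and>
     weakly_associative_deformation s \<mu> \<mu>t \<and>
     \<psi> = skew_bracket (deformation_term \<mu>t 1)"


lemma module_fps_scale:
  assumes "module s"
  shows "module (fps_scale s)"
proof -
  interpret module s by fact
  show ?thesis
  proof
    fix a b :: "'a fps" and x y :: "'b fps"
    show "fps_scale s a (x + y) = fps_scale s a x + fps_scale s a y"
      by (simp add: fps_eq_iff fps_scale_def scale_right_distrib sum.distrib)
    show "fps_scale s (a + b) x = fps_scale s a x + fps_scale s b x"
      by (simp add: fps_eq_iff fps_scale_def scale_left_distrib sum.distrib)
    show "fps_scale s 1 x = x"
    proof (rule fps_ext)
      fix n
      have "fps_nth (fps_scale s 1 x) n =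
          (\<Sum>i\<le>n. if i = 0 then fps_nth x n else 0)"
        unfolding fps_scale_def fps_nth_Abs_fps by (intro sum.cong) auto
      thus "fps_nth (fps_scale s 1 x) n = fps_nth x n" by simp
    qed
    show "fps_scale s a (fps_scale s b x) = fps_scale s (a * b) x"
    proof (rule fps_ext)
      fix n
      have "fps_nth (fps_scale s a (fps_scale s b x)) n =
          (\<Sum>i\<le>n. \<Sum>j\<le>n - i. s (fps_nth a i * fps_nth b j) (fps_nth x (n - i - j)))"
        by (simp add: fps_scale_def scale_sum_right)
      also have "\<dots> = (\<Sum>(i, j)\<in>(SIGMA i:{..n}. {..n - i}).
          s (fps_nth a i * fps_nth b j) (fps_nth x (n - i - j)))"
        by (simp add: sum.Sigma)
      also have "\<dots> = (\<Sum>(k, i)\<in>(SIGMA k:{..n}. {..k}).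
          s (fps_nth a i * fps_nth b (k - i)) (fps_nth x (n - k)))"
        by (rule sum.reindex_bij_witness
            [where i = "\<lambda>(k, i). (i, k - i)" and j = "\<lambda>(i, j). (i + j, i)"]) auto
      also have "\<dots> = fps_nth (fps_scale s (a * b) x) n"
        by (simp add: fps_scale_def sum.Sigma fps_mult_nth scale_sum_left atLeast0AtMost)
      finally show "fps_nth (fps_scale s a (fps_scale s b x)) n =
          fps_nth (fps_scale s (a * b) x) n" .
    qed
  qed
qed

lemma bilinear_ext_bilinear:
  assumes bil: "\<And>i. bilinear_mult s (deformation_term \<mu>t i)"
  shows "bilinear_mult (fps_scale s) (bilinear_ext \<mu>t)"
proof -
  let ?\<phi> = "deformation_term \<mu>t"
  have homr: "module_hom s s (?\<phi> i x)" and homl: "module_hom s s (\<lambda>x. ?\<phi> i x y)" for i x y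
    using bil[of i] by (auto simp: bilinear_mult_def)
  have "module s" using homr unfolding module_hom_def by blast
  then interpret module s .
  note m = module_fps_scale[OF \<open>module s\<close>]
  have addr: "?\<phi> i x (y + z) = ?\<phi> i x y + ?\<phi> i x z"
    and scr: "?\<phi> i x (s c y) = s c (?\<phi> i x y)"
    and sumr: "?\<phi> i x (sum g S) = (\<Sum>a\<in>S. ?\<phi> i x (g a))" for i x y z c and g :: "nat \<Rightarrow> 'b" and S
    using module_hom.add[OF homr] module_hom.scale[OF homr] module_hom.sum[OF homr] by auto
  have addl: "?\<phi> i (y + z) x = ?\<phi> i y x + ?\<phi> i z x"
    and scl: "?\<phi> i (s c y) x = s c (?\<phi> i y x)"
    and suml: "?\<phi> i (sum g S) x = (\<Sum>a\<in>S. ?\<phi> i (g a) x)" for i x y z c and g :: "nat \<Rightarrow> 'b" and S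
    using module_hom.add[OF homl] module_hom.scale[OF homl] module_hom.sum[OF homl] by auto
  have nth: "fps_nth (bilinear_ext \<mu>t x y) n =
      (\<Sum>i\<le>n. \<Sum>j\<le>n - i. ?\<phi> i (fps_nth x j) (fps_nth y (n - i - j)))" for x y n
    by (simp add: bilinear_ext_def deformation_term_def)
  have add: "bilinear_ext \<mu>t x (y + z) = bilinear_ext \<mu>t x y + bilinear_ext \<mu>t x z"
    "bilinear_ext \<mu>t (y + z) x = bilinear_ext \<mu>t y x + bilinear_ext \<mu>t z x" for x y z
    by (simp_all add: fps_eq_iff nth addr addl sum.distrib)
  define Q where "Q c x y n = (\<Sum>(l, i, j) \<in> {(l, i, j). l + i + j \<le> n}.
      s (fps_nth c l) (?\<phi> i (fps_nth x j) (fps_nth y (n - l - i - j))))" for c x y n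
  have sc: "fps_nth (fps_scale s c (bilinear_ext \<mu>t x y)) n = Q c x y n" for c x y n
  proof -
    have "fps_nth (fps_scale s c (bilinear_ext \<mu>t x y)) n =
      (\<Sum>(l, i, j)\<in>(SIGMA l:{..n}. SIGMA i:{..n - l}. {..n - l - i}).
        s (fps_nth c l) (?\<phi> i (fps_nth x j) (fps_nth y (n - l - i - j))))"
      by (simp add: fps_scale_def nth scale_sum_right sum.Sigma split_def)
    also have "\<dots> = Q c x y n" unfolding Q_def by (intro sum.cong) auto
    finally show ?thesis .
  qed
  have scR: "bilinear_ext \<mu>t x (fps_scale s c y) = fps_scale s c (bilinear_ext \<mu>t x y)" for c x y
  proof (rule fps_ext)
    fix n
    have "fps_nth (bilinear_ext \<mu>t x (fps_scale s c y)) n =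
      (\<Sum>(i, j, l)\<in>(SIGMA i:{..n}. SIGMA j:{..n - i}. {..n - i - j}).
        s (fps_nth c l) (?\<phi> i (fps_nth x j) (fps_nth y (n - i - j - l))))"
      by (simp add: fps_scale_def nth sumr scr sum.Sigma)
    also have "\<dots> = Q c x y n" unfolding Q_def
      by (rule sum.reindex_bij_witness
          [where i = "\<lambda>(l, i, j). (i, j, l)" and j = "\<lambda>(i, j, l). (l, i, j)"])
        (auto simp: algebra_simps)
    finally show "fps_nth (bilinear_ext \<mu>t x (fps_scale s c y)) n =
        fps_nth (fps_scale s c (bilinear_ext \<mu>t x y)) n" by (simp add: sc)
  qed
  have scL: "bilinear_ext \<mu>t (fps_scale s c x) y = fps_scale s c (bilinear_ext \<mu>t x y)" for c x y
  proof (rule fps_ext)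
    fix n
    have "fps_nth (bilinear_ext \<mu>t (fps_scale s c x) y) n =
      (\<Sum>(i, j, l)\<in>(SIGMA i:{..n}. SIGMA j:{..n - i}. {..j}).
        s (fps_nth c l) (?\<phi> i (fps_nth x (j - l)) (fps_nth y (n - i - j))))"
      by (simp add: fps_scale_def nth suml scl sum.Sigma)
    also have "\<dots> = Q c x y n" unfolding Q_def
      by (rule sum.reindex_bij_witness
          [where i = "\<lambda>(l, i, j). (i, j + l, l)" and j = "\<lambda>(i, j, l). (l, i, j - l)"])
        (auto simp: algebra_simps)
    finally show "fps_nth (bilinear_ext \<mu>t (fps_scale s c x) y) n =
        fps_nth (fps_scale s c (bilinear_ext \<mu>t x y)) n" by (simp add: sc)
  qed
  show ?thesis
    unfolding bilinear_mult_def module_hom_def module_hom_axioms_def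
    using m add scR scL by blast
qed

lemma bilinear_ext_const:
  assumes bil: "\<And>i. bilinear_mult s (deformation_term \<mu>t i)"
  shows "bilinear_ext \<mu>t (fps_const a) (fps_const b) = \<mu>t a b"
proof (rule fps_ext)
  fix n
  let ?\<phi> = "deformation_term \<mu>t"
  have homr: "module_hom s s (?\<phi> i x)" and homl: "module_hom s s (\<lambda>x. ?\<phi> i x y)" for i x y
    using bil[of i] by (auto simp: bilinear_mult_def)
  have z: "?\<phi> i x 0 = 0" "?\<phi> i 0 x = 0" for i x
    using module_hom.zero[OF homr] module_hom.zero[OF homl] by auto
  have "fps_nth (bilinear_ext \<mu>t (fps_const a) (fps_const b)) n =
     (\<Sum>i\<le>n. \<Sum>j\<le>n - i. ?\<phi> i (fps_nth (fps_const a) j) (fps_nth (fps_const b) (n - i - j)))"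
    by (simp add: bilinear_ext_def deformation_term_def)
  also have "\<dots> = (\<Sum>i\<le>n. \<Sum>j\<le>n - i. if j = 0 then ?\<phi> i a (fps_nth (fps_const b) (n - i)) else 0)"
    by (intro sum.cong) (auto simp: z)
  also have "\<dots> = (\<Sum>i\<le>n. if i = n then ?\<phi> n a b else 0)"
    by (intro sum.cong) (auto simp: z)
  also have "\<dots> = fps_nth (\<mu>t a b) n" by (simp add: deformation_term_def)
  finally show "fps_nth (bilinear_ext \<mu>t (fps_const a) (fps_const b)) n = fps_nth (\<mu>t a b) n" .
qed

lemma bilinear_ext_unique:
  assumes bil: "\<And>i. bilinear_mult s (deformation_term \<mu>t i)"
    and m: "bilinear_mult (fps_scale s) m"
    and ext: "\<And>a b. m (fps_const a) (fps_const b) = \<mu>t a b"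
  shows "m = bilinear_ext \<mu>t"
proof -
  have "module s"
    using bil unfolding bilinear_mult_def module_hom_def by blast
  then interpret module s .
  have shift: "fps_nth (fps_scale s fps_X x) n = (if n = 0 then 0 else fps_nth x (n - 1))" for x n
  proof -
    have "fps_nth (fps_scale s fps_X x) n = (\<Sum>i\<le>n. if i = 1 then fps_nth x (n - 1) else 0)"
      unfolding fps_scale_def fps_nth_Abs_fps by (intro sum.cong) auto
    thus ?thesis by auto
  qed
  define D where "D x y = m x y - bilinear_ext \<mu>t x y" for x y
  note e = bilinear_ext_bilinear[OF bil]
  interpret FM: module "fps_scale s" by (rule module_fps_scale) fact
  have lin: "B (x + x') y = B x y + B x' y" "B x (y + y') = B x y + B x y'"
    "B (fps_scale s c x) y = fps_scale s c (B x y)"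
    "B x (fps_scale s c y) = fps_scale s c (B x y)"
    if "bilinear_mult (fps_scale s) B" for B x y x' y' c
    using that unfolding bilinear_mult_def module_hom_def module_hom_axioms_def by auto
  have Dlin: "D (x + x') y = D x y + D x' y" "D x (y + y') = D x y + D x y'"
    "D (fps_scale s c x) y = fps_scale s c (D x y)"
    "D x (fps_scale s c y) = fps_scale s c (D x y)" for x x' y y' c
    by (simp_all add: D_def lin[OF m] lin[OF e] FM.scale_right_diff_distrib)
  have D0: "D (fps_const a) (fps_const b) = 0" for a b
    by (simp add: D_def ext bilinear_ext_const[OF bil])
  have decomp: "\<exists>a x'. x = fps_const a + fps_scale s fps_X x'" for x :: "'b fps"
    by (rule exI[of _ "fps_nth x 0"], rule exI[of _ "Abs_fps (\<lambda>n. fps_nth x (Suc n))"])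
      (auto simp: fps_eq_iff shift)
  have D_split: "\<exists>z z'. D x y = fps_scale s fps_X (D z y) + fps_scale s fps_X (D z' y')"
    if "y = fps_const b + fps_scale s fps_X y'" for x y b y'
  proof -
    obtain a x' where x: "x = fps_const a + fps_scale s fps_X x'" using decomp by meson
    have "D x y = D (fps_const a) y + fps_scale s fps_X (D x' y)"
      by (simp only: x Dlin)
    also have "D (fps_const a) y = fps_scale s fps_X (D (fps_const a) y')"
      by (simp only: that Dlin D0) simp
    finally show ?thesis by (metis add.commute)
  qed
  have "fps_nth (D x y) n = 0" for x y n
  proof (induction n arbitrary: x y)
    case (0 x y)
    obtain b y' where "y = fps_const b + fps_scale s fps_X y'" using decomp by meson
    from D_split[OF this, of x] show ?case by (auto simp: shift)
  next
    case (Suc n x y)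
    obtain b y' where "y = fps_const b + fps_scale s fps_X y'" using decomp by meson
    from D_split[OF this, of x] show ?case by (auto simp: shift Suc.IH)
  qed
  hence "D x y = 0" for x y by (simp add: fps_eq_iff)
  thus ?thesis by (auto simp: D_def fun_eq_iff)
qed

end

theory Submission imports Defs begin

text \<open>Expand the weak associativity identity on constant series in powers of \<open>t\<close>. As \<open>\<mu>\<close> is
  commutative, everything in the coefficient of \<open>t\<close> cancels except the Leibniz
  rule for \<open>\<psi>\<close>. Antisymmetrising the identity over the three arguments gives
  three times the Jacobi identity for the commutator of \<open>\<mu>t\<close>; this commutator vanishes
  modulo \<open>t\<close>, so the coefficient of \<open>t\<^sup>2\<close> in its Jacobi identity involves \<open>\<psi>\<close> alone. For
  an equivalence \<open>Id + t h\<^sub>1 + \<dots>\<close>, the first-order terms differ by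
  \<open>a h\<^sub>1(b) + h\<^sub>1(a) b - h\<^sub>1(ab)\<close>, which is symmetric in \<open>a\<close> and \<open>b\<close>.\<close>

lemma bilinear_multD:
  assumes "bilinear_mult s m"
  shows "module s"
    and "m x (y + z) = m x y + m x z" "m (x + y) z = m x z + m y z"
    and "m x (y - z) = m x y - m x z" "m (x - y) z = m x z - m y z"
    and "m x (s c y) = s c (m x y)" "m (s c x) y = s c (m x y)"
    and "m x 0 = 0" "m 0 y = 0"
proof -
  have r: "module_hom s s (\<lambda>y. m x y)" and l: "module_hom s s (\<lambda>x. m x y)" for x y
    using assms by (auto simp: bilinear_mult_def)
  show "module s" using r unfolding module_hom_def by blast
  show "m x (y + z) = m x y + m x z" "m x (y - z) = m x y - m x z"
    "m x (s c y) = s c (m x y)" "m x 0 = 0"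
    using module_hom.add[OF r] module_hom.diff[OF r] module_hom.scale[OF r] module_hom.zero[OF r]
    by auto
  show "m (x + y) z = m x z + m y z" "m (x - y) z = m x z - m y z"
    "m (s c x) y = s c (m x y)" "m 0 y = 0"
    using module_hom.add[OF l] module_hom.diff[OF l] module_hom.scale[OF l] module_hom.zero[OF l]
    by auto
qed

lemma bilinear_mult_skew_bracket:
  assumes "bilinear_mult s m"
  shows "bilinear_mult s (skew_bracket m)"
proof -
  note b = bilinear_multD[OF assms]
  interpret module s by (rule b(1))
  show ?thesis
    unfolding bilinear_mult_def module_hom_def module_hom_axioms_def
    using module_axioms by (auto simp: skew_bracket_def b(2-) scale_right_diff_distrib)
qed

text \<open>In the signed sum of the identity over all six permutations, the two even terms enter
  with a plus and the odd one with a minus, so each of the three yields the full signed sum of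
  associators, which is \<open>J\<close>. The factor three is kept as a sum because the scalars are
  an arbitrary commutative ring here.\<close>

lemma skew_bracket_jacobi_three:
  assumes bil: "bilinear_mult s m"
    and w: "\<And>x y z. associator m x y z + associator m y z x - associator m y x z = 0"
    and J: "J = skew_bracket m x (skew_bracket m y z) + skew_bracket m y (skew_bracket m z x) +
        skew_bracket m z (skew_bracket m x y)"
  shows "J + J + J = 0"
proof -
  define W where "W x y z = associator m x y z + associator m y z x - associator m y x z" for x y z
  have "J + J + J = W x y z + W y z x + W z x y - (W y x z + W x z y + W z y x)"
    by (simp add: J W_def skew_bracket_def associator_def bilinear_multD[OF bil] algebra_simps)
  thus ?thesis by (simp add: W_def w)
qed

text \<open>In a nested product of constants the inner product is already a full series, so this
  lemma and its mirror image fix only one factor to be constant; the double sum then collapses to a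
  single one.\<close>

lemma bilinear_ext_const_left_nth:
  assumes "\<And>i. bilinear_mult s (deformation_term \<mu>t i)"
  shows "fps_nth (bilinear_ext \<mu>t (fps_const a) u) n =
    (\<Sum>i\<le>n. deformation_term \<mu>t i a (fps_nth u (n - i)))"
proof -
  note z = bilinear_multD(9)[OF assms]
  have "fps_nth (bilinear_ext \<mu>t (fps_const a) u) n =
     (\<Sum>i\<le>n. \<Sum>j\<le>n - i. deformation_term \<mu>t i (fps_nth (fps_const a) j) (fps_nth u (n - i - j)))"
    by (simp add: bilinear_ext_def deformation_term_def)
  also have "\<dots> = (\<Sum>i\<le>n. \<Sum>j\<le>n - i.
      if j = 0 then deformation_term \<mu>t i a (fps_nth u (n - i)) else 0)"
    by (intro sum.cong) (auto simp: z)
  finally show ?thesis by simp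
qed

lemma bilinear_ext_const_right_nth:
  assumes "\<And>i. bilinear_mult s (deformation_term \<mu>t i)"
  shows "fps_nth (bilinear_ext \<mu>t u (fps_const a)) n =
    (\<Sum>i\<le>n. deformation_term \<mu>t i (fps_nth u (n - i)) a)"
proof -
  note z = bilinear_multD(8)[OF assms]
  have "fps_nth (bilinear_ext \<mu>t u (fps_const a)) n =
     (\<Sum>i\<le>n. \<Sum>j\<le>n - i. deformation_term \<mu>t i (fps_nth u j) (fps_nth (fps_const a) (n - i - j)))"
    by (simp add: bilinear_ext_def deformation_term_def)
  also have "\<dots> = (\<Sum>i\<le>n. \<Sum>j\<le>n - i.
      if j = n - i then deformation_term \<mu>t i (fps_nth u (n - i)) a else 0)"
    by (intro sum.cong) (auto simp: z)
  finally show ?thesis by simp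
qed

lemma deformation_leibniz:
  assumes cm: "comm_assoc_algebra s \<mu>"
    and d: "weakly_associative_deformation s \<mu> \<mu>t"
  defines "\<psi> \<equiv> skew_bracket (deformation_term \<mu>t 1)"
  shows "\<psi> (\<mu> x y) z = \<mu> x (\<psi> y z) + \<mu> (\<psi> x z) y"
proof -
  have bil: "\<And>i. bilinear_mult s (deformation_term \<mu>t i)" and t0: "deformation_term \<mu>t 0 = \<mu>"
    and W: "\<And>x y z. associator (bilinear_ext \<mu>t) x y z + associator (bilinear_ext \<mu>t) y z x
      - associator (bilinear_ext \<mu>t) y x z = 0"
    using d by (auto simp: weakly_associative_deformation_def weakly_associative_algebra_def)
  have com: "\<And>x y. \<mu> x y = \<mu> y x" and b: "bilinear_mult s \<mu>"
    using cm by (auto simp: comm_assoc_algebra_def)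
  let ?f = "deformation_term \<mu>t 1"
  note nth = bilinear_ext_const_left_nth[OF bil] bilinear_ext_const_right_nth[OF bil]
  have A: "fps_nth (associator (bilinear_ext \<mu>t) (fps_const a) (fps_const b) (fps_const c)) 1 =
      \<mu> a (?f b c) + ?f a (\<mu> b c) - (\<mu> (?f a b) c + ?f (\<mu> a b) c)" for a b c
    by (simp add: associator_def nth t0 bilinear_multD(8,9)[OF bil] bilinear_multD(8,9)[OF b])
  \<comment> \<open>The order \<open>z\<close>, \<open>x\<close>, \<open>y\<close> makes
    \<open>?f z (\<mu> x y)\<close> and \<open>?f (\<mu> x y) z\<close> occur with opposite signs,
    giving the left side of the Leibniz rule.\<close>
  have "fps_nth (associator (bilinear_ext \<mu>t) (fps_const z) (fps_const x) (fps_const y)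
      + associator (bilinear_ext \<mu>t) (fps_const x) (fps_const y) (fps_const z)
      - associator (bilinear_ext \<mu>t) (fps_const x) (fps_const z) (fps_const y)) 1 = 0"
    by (simp only: W fps_zero_nth)
  hence "\<mu> z (?f x y) + ?f z (\<mu> x y) - (\<mu> (?f z x) y + ?f (\<mu> z x) y)
      + (\<mu> x (?f y z) + ?f x (\<mu> y z) - (\<mu> (?f x y) z + ?f (\<mu> x y) z))
      - (\<mu> x (?f z y) + ?f x (\<mu> z y) - (\<mu> (?f x z) y + ?f (\<mu> x z) y)) = 0"
    by (simp only: fps_add_nth fps_sub_nth A)
  thus ?thesis
    \<comment> \<open>Moving \<open>z\<close> to the right in every \<open>\<mu>\<close> product
      suffices: the terms in \<open>?f x y\<close>, in \<open>?f (\<mu> x z) y\<close> and in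
      \<open>?f x (\<mu> y z)\<close> then cancel in pairs.\<close>
    unfolding \<psi>_def skew_bracket_def
    by (simp add: bilinear_multD(4,5)[OF b] com[of z] algebra_simps)
qed

lemma deformation_jacobi:
  fixes s :: "'k::field_char_0 \<Rightarrow> 'a::ab_group_add \<Rightarrow> 'a"
  assumes vs: "vector_space s"
    and cm: "comm_assoc_algebra s \<mu>"
    and d: "weakly_associative_deformation s \<mu> \<mu>t"
  defines "\<psi> \<equiv> skew_bracket (deformation_term \<mu>t 1)"
  shows "\<psi> x (\<psi> y z) + \<psi> y (\<psi> z x) + \<psi> z (\<psi> x y) = 0"
proof -
  interpret vector_space s by fact
  have bil: "\<And>i. bilinear_mult s (deformation_term \<mu>t i)" and t0: "deformation_term \<mu>t 0 = \<mu>"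
    and W: "\<And>x y z. associator (bilinear_ext \<mu>t) x y z + associator (bilinear_ext \<mu>t) y z x
      - associator (bilinear_ext \<mu>t) y x z = 0"
    using d by (auto simp: weakly_associative_deformation_def weakly_associative_algebra_def)
  have com: "\<And>x y. \<mu> x y = \<mu> y x" using cm by (auto simp: comm_assoc_algebra_def)
  let ?B = "skew_bracket (bilinear_ext \<mu>t)"
  note nth = bilinear_ext_const_left_nth[OF bil] bilinear_ext_const_right_nth[OF bil]
  have B: "fps_nth (?B (fps_const a) (fps_const b)) 0 = 0"
    "fps_nth (?B (fps_const a) (fps_const b)) 1 = \<psi> a b" for a b
    using com[of a b]
    by (simp_all add: skew_bracket_def[of "bilinear_ext \<mu>t"] nth t0 bilinear_multD(8,9)[OF bil]
        bilinear_multD(8,9)[OF bil[of 0], unfolded t0] \<psi>_def skew_bracket_def)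
  have BB: "fps_nth (?B (fps_const a) (?B (fps_const b) (fps_const c))) 2 = \<psi> a (\<psi> b c)" for a b c
  proof -
    let ?u = "?B (fps_const b) (fps_const c)"
    have "fps_nth (?B (fps_const a) ?u) 2 =
      (\<Sum>i\<le>2. deformation_term \<mu>t i a (fps_nth ?u (2 - i)))
      - (\<Sum>i\<le>2. deformation_term \<mu>t i (fps_nth ?u (2 - i)) a)"
      by (simp add: skew_bracket_def[of _ "fps_const a"] nth)
    \<comment> \<open>The terms for \<open>i = 0\<close> cancel between the two sums by
      commutativity of \<open>\<mu>\<close>, those for \<open>i = 2\<close> vanish because
      \<open>?u\<close> has constant coefficient 0, and \<open>i = 1\<close> meets the coefficient
      \<open>\<psi> b c\<close> of \<open>?u\<close>.\<close>
    also have "\<dots> = \<psi> a (\<psi> b c)"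
      using com[of a] B
      by (simp add: numeral_2_eq_2 t0 bilinear_multD(8,9)[OF bil] \<psi>_def
          skew_bracket_def[of "deformation_term \<mu>t (Suc 0)" a])
    finally show ?thesis .
  qed
  define J where "J = ?B (fps_const x) (?B (fps_const y) (fps_const z))
    + ?B (fps_const y) (?B (fps_const z) (fps_const x))
    + ?B (fps_const z) (?B (fps_const x) (fps_const y))"
  let ?j = "\<psi> x (\<psi> y z) + \<psi> y (\<psi> z x) + \<psi> z (\<psi> x y)"
  have "J + J + J = 0"
    by (rule skew_bracket_jacobi_three[OF bilinear_ext_bilinear[OF bil] W J_def])
  hence "fps_nth (J + J + J) 2 = 0" by simp
  hence "?j + ?j + ?j = 0"
    by (simp only: J_def fps_add_nth BB)
  \<comment> \<open>Rewriting the triple sum as a scalar multiple allows cancelling 3, which is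
    nonzero in characteristic 0.\<close>
  moreover have "s 3 v = v + v + v" for v
    using scale_left_distrib[of 1 2 v] scale_left_distrib[of 1 1 v] by (simp add: algebra_simps)
  ultimately have "s 3 ?j = 0" by simp
  thus ?thesis by (simp only: scale_eq_0_iff) simp
qed

lemma equivalent_deformations_skew_bracket:
  assumes cm: "comm_assoc_algebra s \<mu>"
    and d: "weakly_associative_deformation s \<mu> \<mu>t"
    and d': "weakly_associative_deformation s \<mu> \<mu>t'"
    and e: "equivalent_deformations s \<mu>t \<mu>t'"
  shows "skew_bracket (deformation_term \<mu>t' 1) = skew_bracket (deformation_term \<mu>t 1)"
proof -
  have bil: "\<And>i. bilinear_mult s (deformation_term \<mu>t i)" and t0: "deformation_term \<mu>t 0 = \<mu>"
    using d by (auto simp: weakly_associative_deformation_def)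
  have t0': "deformation_term \<mu>t' 0 = \<mu>"
    using d' by (auto simp: weakly_associative_deformation_def)
  have com: "\<And>x y. \<mu> x y = \<mu> y x" using cm by (auto simp: comm_assoc_algebra_def)
  obtain h where h0: "h 0 = id" and hn: "\<And>n. module_hom s s (h n)"
    and hom: "\<And>x y. linear_ext h (bilinear_ext \<mu>t x y) =
      bilinear_ext \<mu>t' (linear_ext h x) (linear_ext h y)"
    using e by (auto simp: equivalent_deformations_def algebra_iso_def)
  have hz: "h n 0 = 0" for n using module_hom.zero[OF hn] .
  \<comment> \<open>The expansion in \<open>key\<close> unfolds \<open>deformation_term\<close>, so
    the zeroth-order terms are needed as raw coefficients.\<close>
  have nth0: "fps_nth (\<mu>t a b) 0 = \<mu> a b" "fps_nth (\<mu>t' a b) 0 = \<mu> a b" for a b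
    using t0 t0' by (metis deformation_term_def)+
  \<comment> \<open>This is the coefficient of \<open>t\<close> in multiplicativity on constants;
    \<open>h 0 = id\<close> leaves \<open>h 1\<close> as the only correction.\<close>
  have key: "deformation_term \<mu>t 1 a b + h 1 (\<mu> a b) =
      \<mu> a (h 1 b) + \<mu> (h 1 a) b + deformation_term \<mu>t' 1 a b" for a b
  proof -
    have "fps_nth (linear_ext h (bilinear_ext \<mu>t (fps_const a) (fps_const b))) 1 =
      fps_nth (bilinear_ext \<mu>t' (linear_ext h (fps_const a)) (linear_ext h (fps_const b))) 1"
      by (simp add: hom)
    thus ?thesis
      by (simp add: bilinear_ext_const[OF bil] linear_ext_def bilinear_ext_def h0 hz
          nth0 bilinear_multD(8,9)[OF bil[of 0], unfolded t0] deformation_term_def add_ac)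
  qed
  have "deformation_term \<mu>t 1 a b - deformation_term \<mu>t' 1 a b =
      \<mu> a (h 1 b) + \<mu> (h 1 a) b - h 1 (\<mu> a b)" for a b
    using key[of a b] by (simp add: algebra_simps)
  \<comment> \<open>Exchanging \<open>a\<close> and \<open>b\<close> swaps the two products
    containing \<open>h 1\<close>, by commutativity, and fixes
    \<open>h 1 (\<mu> a b)\<close>.\<close>
  hence "deformation_term \<mu>t 1 a b - deformation_term \<mu>t' 1 a b =
      deformation_term \<mu>t 1 b a - deformation_term \<mu>t' 1 b a" for a b
    using com by (metis add.commute)
  thus ?thesis by (simp add: fun_eq_iff skew_bracket_def algebra_simps)
qed

theorem proposition21:
  fixes s :: "'k::field_char_0 \<Rightarrow> 'a::ab_group_add \<Rightarrow> 'a"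
    and \<mu> :: "'a \<Rightarrow> 'a \<Rightarrow> 'a"
    and \<mu>t :: "'a \<Rightarrow> 'a \<Rightarrow> 'a fps"
  assumes "vector_space s"
    and "comm_assoc_algebra s \<mu>"
    and "weakly_associative_deformation s \<mu> \<mu>t"
  shows "poisson_algebra s \<mu> (skew_bracket (deformation_term \<mu>t 1)) \<and>
    quantization s \<mu> (skew_bracket (deformation_term \<mu>t 1)) \<mu>t \<and>
    (\<forall>\<mu>t'. weakly_associative_deformation s \<mu> \<mu>t' \<and> equivalent_deformations s \<mu>t \<mu>t' \<longrightarrow>
       skew_bracket (deformation_term \<mu>t' 1) = skew_bracket (deformation_term \<mu>t 1))"
proof -
  let ?\<psi> = "skew_bracket (deformation_term \<mu>t 1)"
  have "lie_bracket s ?\<psi>"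
    unfolding lie_bracket_def
  proof (intro conjI allI)
    show "bilinear_mult s ?\<psi>"
      using assms(3) bilinear_mult_skew_bracket by (auto simp: weakly_associative_deformation_def)
    show "?\<psi> x x = 0" for x by (simp add: skew_bracket_def)
  qed (rule deformation_jacobi[OF assms])
  hence "poisson_algebra s \<mu> ?\<psi>"
    using assms(2) deformation_leibniz[OF assms(2,3)] by (auto simp: poisson_algebra_def)
  thus ?thesis
    using assms(3) equivalent_deformations_skew_bracket[OF assms(2,3)]
    by (auto simp: quantization_def)
qed

end
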